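(* Let $SA_1\ldots A_n$ be a simplex in $\mathbb R^n$ that is right at $S$, let $L$ be a $k$-dimensional linear subspace of $\mathbb R^n$ (through $S$) with $1\le k\le n-1$ and orthogonal projection $Q$, and let $\lambda$ be a real number. Then $$\sum_{i=1}^{n}\frac{B_iH_i^{2}}{SA_i^{2}}=n\lambda^{2}-2k\lambda+k,$$ and $$\sum_{i=1}^{n}B_iH_i\le\sqrt{n\lambda^{2}-2k\lambda+k}\;SP.$$ Equality in the last inequality holds if and only if there is a constant $c>0$ such that $SA_i=c\,\lVert(Q-\lambda I)\mathbf e_i\rVert$ for all $1\le i\le n$.
   Context: $SA_1\ldots A_n$ is a simplex in Euclidean space $\mathbb R^n$, with $S$ identified with the origin; $\mathbf u_i=\overrightarrow{SA_i}$ and $\mathbf e_i=\mathbf u_i/\lVert\mathbf u_i\rVert$. The simplex is right at $S$ if $SA_i\perp SA_j$ for all $i\neq j$. In that case $P$ is the vertex opposite $S$ of the orthotope (rectangular box) spanned by the edges at $S$, so $SP^2=\sum_{i=1}^n SA_i^2$. $H_i$ is the orthogonal projection of $A_i$ onto $L$ (so $\overrightarrow{SH_i}=Q\mathbf u_i$), and $B_i$ is the point with $\overrightarrow{SB_i}=\lambda\mathbf u_i$. For points $X,Y$, $XY$ denotes their Euclidean distance. *)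

theory Defs
  imports "HOL-Analysis.Analysis"
begin

text \<open>The vertices of a simplex in \<open>\<real>\<^sup>n\<close>, \<open>n = CARD('n)\<close>, are a point \<open>S\<close> and a family \<open>A\<close>
  indexed by the type \<open>'n\<close>. The first two conjuncts make the \<open>n + 1\<close> points distinct, which
  \<open>affine_dependent\<close>, a property of a set, does not see.\<close>

definition is_simplex :: "real ^ 'n \<Rightarrow> ('n \<Rightarrow> real ^ 'n) \<Rightarrow> bool" where
  "is_simplex S A \<longleftrightarrow> inj A \<and> S \<notin> range A \<and> \<not> affine_dependent (insert S (range A))"

definition right_simplex :: "real ^ 'n \<Rightarrow> ('n \<Rightarrow> real ^ 'n) \<Rightarrow> bool" where
  "right_simplex S A \<longleftrightarrow>
     is_simplex S A \<and> (\<forall>i j. i \<noteq> j \<longrightarrow> orthogonal (A i - S) (A j - S))"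

definition opposite_vertex :: "real ^ 'n \<Rightarrow> ('n \<Rightarrow> real ^ 'n) \<Rightarrow> real ^ 'n" where
  "opposite_vertex S A = S + (\<Sum>i\<in>UNIV. A i - S)"

definition orth_proj :: "(real ^ 'n) set \<Rightarrow> real ^ 'n \<Rightarrow> real ^ 'n" where
  "orth_proj L x = (THE y. y \<in> L \<and> (\<forall>z\<in>L. orthogonal (x - y) z))"

text \<open>On a linear subspace the definite description is proper.\<close>

lemma orth_proj_ex1:
  fixes L :: "(real ^ 'n) set"
  assumes "subspace L"
  shows "\<exists>!y. y \<in> L \<and> (\<forall>z\<in>L. orthogonal (x - y) z)"
proof (rule ex_ex1I)
  obtain y w where y: "y \<in> span L" and w: "\<And>v. v \<in> span L \<Longrightarrow> orthogonal w v" and "x = y + w"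
    using orthogonal_subspace_decomp_exists[of L x] by metis
  then have "x - y = w" by simp
  with y w show "\<exists>y. y \<in> L \<and> (\<forall>z\<in>L. orthogonal (x - y) z)"
    using assms by (metis span_eq_iff)
next
  fix y y' assume h: "y \<in> L \<and> (\<forall>z\<in>L. orthogonal (x - y) z)"
    "y' \<in> L \<and> (\<forall>z\<in>L. orthogonal (x - y') z)"
  then have "y - y' \<in> L" using assms by (simp add: subspace_diff)
  with h have "(x - y) \<bullet> (y - y') = 0" "(x - y') \<bullet> (y - y') = 0"
    by (auto simp: orthogonal_def)
  then have "(y - y') \<bullet> (y - y') = 0" by (simp add: inner_diff_left)
  then show "y = y'" by simp
qed

lemma orth_proj:
  fixes L :: "(real ^ 'n) set"
  assumes "subspace L"
  shows "orth_proj L x \<in> L" and "z \<in> L \<Longrightarrow> orthogonal (x - orth_proj L x) z"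
  using theI'[OF orth_proj_ex1[OF assms, of x]] by (auto simp: orth_proj_def)

end

theory Submission
  imports Defs
begin

text \<open>The unit edge vectors \<open>e\<^sub>i\<close> form an orthonormal basis of \<open>\<real>\<^sup>n\<close>, and scaling gives
  \<open>B\<^sub>iH\<^sub>i = SA\<^sub>i \<cdot> w\<^sub>i\<close> with \<open>w\<^sub>i = \<parallel>(Q - \<lambda>I) e\<^sub>i\<parallel>\<close>. So the sum of the squared ratios is
  \<open>\<Sum> w\<^sub>i\<^sup>2\<close>, the squared Frobenius norm of \<open>Q - \<lambda>I\<close>. As \<open>\<parallel>Qx - \<lambda>x\<parallel>\<^sup>2 = (1 - 2\<lambda>)\<parallel>Qx\<parallel>\<^sup>2 + \<lambda>\<^sup>2\<parallel>x\<parallel>\<^sup>2\<close>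
  for an orthogonal projection, it is enough to know that \<open>\<Sum> \<parallel>Qe\<^sub>i\<parallel>\<^sup>2 = k\<close>, which says that the
  trace of a projection is its rank (\<open>sum_norm_orth_proj_squared\<close>).

  The inequality is the Cauchy--Schwarz inequality for the vectors \<open>(SA\<^sub>i)\<close> and \<open>(w\<^sub>i)\<close>, where
  Pythagoras identifies the norm of the first with \<open>SP\<close>. Equality holds exactly when the two are
  nonnegatively proportional. Because \<open>1 \<le> k < n\<close>, the quadratic \<open>n\<lambda>\<^sup>2 - 2k\<lambda> + k\<close> has negative
  discriminant, so \<open>(w\<^sub>i)\<close> is not zero and proportionality takes the form \<open>SA\<^sub>i = c w\<^sub>i\<close>.\<close>

text \<open>The difference of the two sides lies in \<open>span U\<close> and is orthogonal to \<open>U\<close>, hence to itself.\<close>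

lemma orthonormal_expansion:
  fixes U :: "'a::real_inner set"
  assumes fin: "finite U" and orth: "pairwise orthogonal U"
    and unit: "\<And>u. u \<in> U \<Longrightarrow> norm u = 1" and x: "x \<in> span U"
  shows "x = (\<Sum>u\<in>U. (x \<bullet> u) *\<^sub>R u)"
proof -
  define y where "y = x - (\<Sum>u\<in>U. (x \<bullet> u) *\<^sub>R u)"
  have "orthogonal y v" if v: "v \<in> U" for v
  proof -
    have "u \<bullet> v = (if u = v then 1 else 0)" if "u \<in> U" for u
      using that v orth unit[OF v] by (auto simp: pairwise_def orthogonal_def norm_eq_1)
    then have "(\<Sum>u\<in>U. (x \<bullet> u) *\<^sub>R u) \<bullet> v = (\<Sum>u\<in>U. if u = v then x \<bullet> u else 0)"
      unfolding inner_sum_left by (intro sum.cong) auto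
    then show ?thesis
      using fin v by (simp add: y_def orthogonal_def inner_diff_left)
  qed
  moreover have "y \<in> span U"
    unfolding y_def by (intro span_diff x span_sum span_scale span_base)
  ultimately have "orthogonal y y"
    by (meson orthogonal_to_span)
  then show ?thesis
    by (simp add: y_def orthogonal_self)
qed

lemma Parseval_orthonormal:
  fixes U :: "'a::real_inner set"
  assumes fin: "finite U" and orth: "pairwise orthogonal U"
    and unit: "\<And>u. u \<in> U \<Longrightarrow> norm u = 1" and x: "x \<in> span U"
  shows "(norm x)\<^sup>2 = (\<Sum>u\<in>U. (x \<bullet> u)\<^sup>2)"
proof -
  have "(norm x)\<^sup>2 = x \<bullet> (\<Sum>u\<in>U. (x \<bullet> u) *\<^sub>R u)"
    using orthonormal_expansion[OF assms] by (simp add: power2_norm_eq_inner)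
  then show ?thesis
    by (simp add: inner_sum_right power2_eq_square)
qed

text \<open>There are as many indices as dimensions, so an orthonormal family indexed by \<open>'n\<close> spans
  \<open>real ^ 'n\<close>, and Parseval applies to every vector.\<close>

lemma Parseval_orthonormal_family:
  fixes e :: "'n \<Rightarrow> real ^ 'n"
  assumes unit: "\<And>i. norm (e i) = 1"
    and orth: "\<And>i j. i \<noteq> j \<Longrightarrow> orthogonal (e i) (e j)"
  shows "(norm x)\<^sup>2 = (\<Sum>i\<in>UNIV. (x \<bullet> e i)\<^sup>2)"
proof -
  have inj: "inj e"
  proof (rule injI, rule ccontr)
    fix i j assume "e i = e j" "i \<noteq> j"
    then have "e i = 0" using orth[of i j] by (simp add: orthogonal_self)
    then show False using unit[of i] by simp
  qed
  have pw: "pairwise orthogonal (range e)"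
    using orth by (metis pairwise_imageI)
  have "0 \<notin> range e" using unit by (metis norm_zero rangeE zero_neq_one)
  with pw have "independent (range e)"
    by (rule pairwise_orthogonal_independent)
  moreover have "card (range e) = DIM(real ^ 'n)"
    using inj by (simp add: card_image)
  ultimately have "span (range e) = UNIV"
    using card_ge_dim_independent[of "range e" UNIV] by auto
  then have "(norm x)\<^sup>2 = (\<Sum>u\<in>range e. (x \<bullet> u)\<^sup>2)"
    using pw unit by (intro Parseval_orthonormal) auto
  then show ?thesis
    by (simp add: sum.reindex[OF inj])
qed

lemma orth_proj_eqI:
  assumes "subspace L" "y \<in> L" "\<And>z. z \<in> L \<Longrightarrow> orthogonal (x - y) z"
  shows "orth_proj L x = y"
  unfolding orth_proj_def
  by (rule the1_equality[OF orth_proj_ex1[OF assms(1)]]) (use assms(2,3) in blast)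

lemma orth_proj_scaleR:
  assumes "subspace L"
  shows "orth_proj L (c *\<^sub>R x) = c *\<^sub>R orth_proj L x"
proof (rule orth_proj_eqI[OF assms])
  show "c *\<^sub>R orth_proj L x \<in> L"
    using assms orth_proj(1)[OF assms] by (simp add: subspace_scale)
  show "orthogonal (c *\<^sub>R x - c *\<^sub>R orth_proj L x) z" if "z \<in> L" for z
    using orth_proj(2)[OF assms that, of x]
    by (simp add: orthogonal_def inner_diff_left)
qed

text \<open>The mixed term of the expanded square is \<open>x \<bullet> Qx = \<parallel>Qx\<parallel>\<^sup>2\<close>, because \<open>x - Qx\<close> is orthogonal to
  \<open>Qx\<close>.\<close>

lemma norm_orth_proj_minus_scaleR_squared:
  assumes "subspace L"
  shows "(norm (orth_proj L x - c *\<^sub>R x))\<^sup>2 = (1 - 2 * c) * (norm (orth_proj L x))\<^sup>2 + c\<^sup>2 * (norm x)\<^sup>2"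
proof -
  have "orthogonal (x - orth_proj L x) (orth_proj L x)"
    using assms by (intro orth_proj)
  then have "x \<bullet> orth_proj L x = orth_proj L x \<bullet> orth_proj L x"
    unfolding orthogonal_def inner_diff_left by linarith
  then show ?thesis
    unfolding power2_norm_eq_inner using inner_commute[of x "orth_proj L x"]
    by (simp add: power2_eq_square algebra_simps)
qed

text \<open>Expand \<open>Qe\<^sub>i\<close> in an orthonormal basis \<open>U\<close> of \<open>L\<close>, and exchange the summations over \<open>i\<close> and \<open>U\<close>:
  each \<open>u \<in> U\<close> then contributes \<open>\<Sum>\<^sub>i (e\<^sub>i \<bullet> u)\<^sup>2 = \<parallel>u\<parallel>\<^sup>2 = 1\<close>. This is the equality of the trace and
  the rank of a projection.\<close>

lemma sum_norm_orth_proj_squared: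
  fixes e :: "'n \<Rightarrow> real ^ 'n"
  assumes L: "subspace L"
    and unit: "\<And>i. norm (e i) = 1"
    and orth: "\<And>i j. i \<noteq> j \<Longrightarrow> orthogonal (e i) (e j)"
  shows "(\<Sum>i\<in>UNIV. (norm (orth_proj L (e i)))\<^sup>2) = real (dim L)"
proof -
  obtain U where U: "U \<subseteq> L" "pairwise orthogonal U" "\<And>u. u \<in> U \<Longrightarrow> norm u = 1"
      "independent U" "card U = dim L" "span U = L"
    using orthonormal_basis_subspace[OF L] by metis
  have fin: "finite U" using U(4) by (rule independent_imp_finite)
  have proj: "(norm (orth_proj L x))\<^sup>2 = (\<Sum>u\<in>U. (u \<bullet> x)\<^sup>2)" for x
  proof -
    have "orth_proj L x \<bullet> u = u \<bullet> x" if "u \<in> U" for u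
      using orth_proj(2)[OF L, of u x] that U(1) inner_commute[of x u]
      by (auto simp: orthogonal_def inner_diff_left)
    moreover have "(norm (orth_proj L x))\<^sup>2 = (\<Sum>u\<in>U. (orth_proj L x \<bullet> u)\<^sup>2)"
      using U orth_proj(1)[OF L] by (intro Parseval_orthonormal fin) auto
    ultimately show ?thesis by simp
  qed
  have "(\<Sum>i\<in>UNIV. (norm (orth_proj L (e i)))\<^sup>2) = (\<Sum>u\<in>U. \<Sum>i\<in>UNIV. (u \<bullet> e i)\<^sup>2)"
    unfolding proj by (rule sum.swap)
  also have "\<dots> = (\<Sum>u\<in>U. (norm u)\<^sup>2)"
    by (simp only: Parseval_orthonormal_family[OF unit orth])
  also have "\<dots> = real (dim L)"
    using U(3,5) by simp
  finally show ?thesis .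
qed

lemma sum_norm_orth_proj_minus_scaleR_squared:
  fixes e :: "'n \<Rightarrow> real ^ 'n"
  assumes L: "subspace L"
    and unit: "\<And>i. norm (e i) = 1"
    and orth: "\<And>i j. i \<noteq> j \<Longrightarrow> orthogonal (e i) (e j)"
  shows "(\<Sum>i\<in>UNIV. (norm (orth_proj L (e i) - c *\<^sub>R e i))\<^sup>2)
    = real CARD('n) * c\<^sup>2 - 2 * real (dim L) * c + real (dim L)"
proof -
  have "(\<Sum>i\<in>UNIV. (norm (orth_proj L (e i) - c *\<^sub>R e i))\<^sup>2)
      = (1 - 2 * c) * (\<Sum>i\<in>UNIV. (norm (orth_proj L (e i)))\<^sup>2) + real CARD('n) * c\<^sup>2"
    by (simp add: norm_orth_proj_minus_scaleR_squared[OF L] unit sum.distrib sum_distrib_left)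
  then show ?thesis
    by (simp add: sum_norm_orth_proj_squared[OF assms] algebra_simps)
qed

lemma quadratic_pos:
  fixes n k c :: real
  assumes "0 < k" "k < n"
  shows "0 < n * c\<^sup>2 - 2 * k * c + k"
proof -
  have "n * c\<^sup>2 - 2 * k * c + k = (n - k) * c\<^sup>2 + k * (c - 1)\<^sup>2"
    by (simp add: power2_eq_square algebra_simps)
  moreover have "0 < (n - k) * c\<^sup>2 + k * (c - 1)\<^sup>2"
  proof (cases "c = 0")
    case False
    then have "0 < (n - k) * c\<^sup>2" using assms by simp
    moreover have "0 \<le> k * (c - 1)\<^sup>2" using assms by simp
    ultimately show ?thesis by linarith
  qed (use assms in simp)
  ultimately show ?thesis by simp
qed

text \<open>Equality for vectors \<open>w\<close> and \<open>a\<close> means \<open>\<parallel>w\<parallel> a = \<parallel>a\<parallel> w\<close>. Since neither vector is zero, one can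
  divide by \<open>\<parallel>w\<parallel>\<close>, and the factor \<open>c = \<parallel>a\<parallel> / \<parallel>w\<parallel>\<close> is positive.\<close>

lemma Cauchy_Schwarz_coordinates:
  fixes a w :: "'n::finite \<Rightarrow> real"
  assumes a: "\<And>i. 0 < a i" and w: "0 < (\<Sum>i\<in>UNIV. (w i)\<^sup>2)"
  shows "(\<Sum>i\<in>UNIV. a i * w i) \<le> sqrt (\<Sum>i\<in>UNIV. (w i)\<^sup>2) * sqrt (\<Sum>i\<in>UNIV. (a i)\<^sup>2)"
    and "(\<Sum>i\<in>UNIV. a i * w i) = sqrt (\<Sum>i\<in>UNIV. (w i)\<^sup>2) * sqrt (\<Sum>i\<in>UNIV. (a i)\<^sup>2)
      \<longleftrightarrow> (\<exists>c>0. \<forall>i. a i = c * w i)"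
proof -
  define x where "x = (\<chi> i. w i)"
  define y where "y = (\<chi> i. a i)"
  have xy: "x \<bullet> y = (\<Sum>i\<in>UNIV. a i * w i)"
    by (simp add: x_def y_def inner_vec_def mult.commute)
  have nx: "norm x = sqrt (\<Sum>i\<in>UNIV. (w i)\<^sup>2)" and ny: "norm y = sqrt (\<Sum>i\<in>UNIV. (a i)\<^sup>2)"
    by (simp_all add: x_def y_def norm_vec_def L2_set_def)
  show "(\<Sum>i\<in>UNIV. a i * w i) \<le> sqrt (\<Sum>i\<in>UNIV. (w i)\<^sup>2) * sqrt (\<Sum>i\<in>UNIV. (a i)\<^sup>2)"
    using norm_cauchy_schwarz[of x y] by (simp only: xy nx ny)
  have x: "0 < norm x" using w nx by simp
  have "y \<noteq> 0"
    using a by (metis less_irrefl vec_lambda_beta y_def zero_index)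
  then have y: "0 < norm y" by simp
  have "(norm x *\<^sub>R y = norm y *\<^sub>R x) \<longleftrightarrow> (\<exists>c>0. y = c *\<^sub>R x)"
  proof
    assume "norm x *\<^sub>R y = norm y *\<^sub>R x"
    then have "y = (norm y / norm x) *\<^sub>R x"
      using x by (simp add: eq_vector_fraction_iff)
    then show "\<exists>c>0. y = c *\<^sub>R x" using x y by (metis divide_pos_pos)
  qed auto
  moreover have "y = c *\<^sub>R x \<longleftrightarrow> (\<forall>i. a i = c * w i)" for c
    by (simp add: x_def y_def vec_eq_iff)
  ultimately show "(\<Sum>i\<in>UNIV. a i * w i) = sqrt (\<Sum>i\<in>UNIV. (w i)\<^sup>2) * sqrt (\<Sum>i\<in>UNIV. (a i)\<^sup>2)
      \<longleftrightarrow> (\<exists>c>0. \<forall>i. a i = c * w i)"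
    using norm_cauchy_schwarz_eq[of x y] by (simp only: xy nx ny)
qed

theorem theorem3p1:
  fixes S P :: "real ^ 'n"
    and A H B e :: "'n \<Rightarrow> real ^ 'n"
    and L :: "(real ^ 'n) set"
    and Q :: "real ^ 'n \<Rightarrow> real ^ 'n"
    and k :: nat
    and lam :: real
  assumes "S = 0"
    and "right_simplex S A"
    and "subspace L" and "dim L = k" and "1 \<le> k" and "k \<le> CARD('n) - 1"
    and "Q = orth_proj L"
    and "P = opposite_vertex S A"
    and "\<And>i. e i = (A i - S) /\<^sub>R norm (A i - S)"
    and "\<And>i. H i = Q (A i)"
    and "\<And>i. B i - S = lam *\<^sub>R (A i - S)"
  shows "(\<Sum>i\<in>UNIV. (dist (B i) (H i))\<^sup>2 / (dist S (A i))\<^sup>2)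
           = real CARD('n) * lam\<^sup>2 - 2 * real k * lam + real k
       \<and> (\<Sum>i\<in>UNIV. dist (B i) (H i))
           \<le> sqrt (real CARD('n) * lam\<^sup>2 - 2 * real k * lam + real k) * dist S P
       \<and> ((\<Sum>i\<in>UNIV. dist (B i) (H i))
             = sqrt (real CARD('n) * lam\<^sup>2 - 2 * real k * lam + real k) * dist S P
           \<longleftrightarrow> (\<exists>c>0. \<forall>i. dist S (A i) = c * norm (Q (e i) - lam *\<^sub>R e i)))"
proof -
  define a where "a i = norm (A i)" for i
  define w where "w i = norm (Q (e i) - lam *\<^sub>R e i)" for i
  let ?K = "real CARD('n) * lam\<^sup>2 - 2 * real k * lam + real k"
  have A0: "A i \<noteq> 0" for i
    using assms(1,2) by (metis is_simplex_def rangeI right_simplex_def)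
  have a_pos: "0 < a i" for i
    using A0 by (simp add: a_def)
  have orthA: "orthogonal (A i) (A j)" if "i \<noteq> j" for i j
    using assms(1,2) that by (auto simp: right_simplex_def)
  have unit: "norm (e i) = 1" for i
    using A0 by (simp add: assms(1,9))
  have orth: "orthogonal (e i) (e j)" if "i \<noteq> j" for i j
    using orthA[OF that] by (simp add: assms(1,9) orthogonal_clauses)
  have Ae: "A i = a i *\<^sub>R e i" for i
    using A0[of i] by (simp add: assms(1,9) a_def)
  have sum_w: "(\<Sum>i\<in>UNIV. (w i)\<^sup>2) = ?K"
    unfolding w_def assms(7)
    using sum_norm_orth_proj_minus_scaleR_squared[OF assms(3) unit orth, where c = lam]
    by (simp add: assms(4))
  have K_pos: "0 < ?K"
    by (rule quadratic_pos) (use assms(5,6) in auto)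
  have SA: "dist S (A i) = a i" for i
    by (simp add: assms(1) a_def)
  have BH: "dist (B i) (H i) = a i * w i" for i
  proof -
    have "B i = lam *\<^sub>R A i"
      using assms(11)[of i] by (simp add: assms(1))
    moreover have "H i = a i *\<^sub>R Q (e i)"
      using Ae[of i] by (simp add: assms(7,10) orth_proj_scaleR[OF assms(3)])
    ultimately have "H i - B i = a i *\<^sub>R (Q (e i) - lam *\<^sub>R e i)"
      using Ae[of i] by (simp add: scaleR_diff_right mult.commute)
    then have "norm (H i - B i) = a i * w i"
      using a_pos[of i] by (simp add: w_def)
    then show ?thesis by (simp add: dist_norm norm_minus_commute)
  qed
  have SP: "dist S P = sqrt (\<Sum>i\<in>UNIV. (a i)\<^sup>2)"
  proof -
    have "(norm (\<Sum>i\<in>UNIV. A i))\<^sup>2 = (\<Sum>i\<in>UNIV. (a i)\<^sup>2)"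
      unfolding a_def by (rule norm_sum_Pythagorean) (use orthA in \<open>auto simp: pairwise_def\<close>)
    then have "norm (\<Sum>i\<in>UNIV. A i) = sqrt (\<Sum>i\<in>UNIV. (a i)\<^sup>2)"
      by (metis norm_ge_zero real_sqrt_unique)
    then show ?thesis
      by (simp add: assms(1,8) opposite_vertex_def)
  qed
  have "(dist (B i) (H i))\<^sup>2 / (dist S (A i))\<^sup>2 = (w i)\<^sup>2" for i
    using a_pos[of i] by (simp add: BH SA power_mult_distrib)
  then have "(\<Sum>i\<in>UNIV. (dist (B i) (H i))\<^sup>2 / (dist S (A i))\<^sup>2) = ?K"
    using sum_w by simp
  moreover note Cauchy_Schwarz_coordinates[of a w, OF a_pos, unfolded sum_w, OF K_pos]
  ultimately show ?thesis
    unfolding BH SA SP w_def by blast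
qed

end
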